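(* Let $\mathcal{U}\subseteq\mathbb{F}^n$ be the non-primitive $\alpha$-hypercircle associated to $u(t)=\frac{at+b}{t+d}\in\mathbb{K}(\alpha)(t)$, and let $r=[\mathbb{K}(d):\mathbb{K}]$. Let $\mathcal{V}\subseteq\mathbb{F}^r$ be the hypercircle generated by the unit $\frac{1}{t+d}$ in the extension $\mathbb{K}\subseteq\mathbb{K}(d)$ (with respect to the primitive element $d$). Then there is an affine inclusion (an injective affine map) from $\mathbb{F}^r$ to $\mathbb{F}^n$, defined over $\mathbb{K}$, that maps the hypercircle $\mathcal{V}$ onto $\mathcal{U}$.
   Context: $\mathbb{K}$ is a field of characteristic zero, $\mathbb{L}=\mathbb{K}(\alpha)$ is a finite algebraic extension of $\mathbb{K}$ of degree $n$ with primitive element $\alpha$, and $\mathbb{F}$ is the algebraic closure of $\mathbb{K}$. A unit of $\mathbb{L}(t)$ (under composition) is a rational function $u(t)=\frac{at+b}{ct+d}$ with $a,b,c,d\in\mathbb{L}$, $ad-bc\neq 0$. Every unit $u(t)\in\mathbb{L}(t)$ is written uniquely as $u(t)=\sum_{i=0}^{n-1}\phi_i(t)\alpha^i$ with $\phi_i(t)\in\mathbb{K}(t)$, and the $\alpha$-hypercircle generated by (or associated to) $u(t)$ is the rational curve in $\mathbb{F}^n$ parametrized by $(\phi_0(t),\ldots,\phi_{n-1}(t))$ (Zariski closure of the image). The same definition applies to any finite extension with a chosen primitive element; in particular, for the extension $\mathbb{K}\subseteq\mathbb{K}(d)$ of degree $r$ with primitive element $d$, one expands in powers $1,d,\ldots,d^{r-1}$.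 An $\alpha$-hypercircle is primitive if its degree as a curve equals $n=[\mathbb{K}(\alpha):\mathbb{K}]$, and non-primitive otherwise. *)

theory Defs
  imports
    "HOL-Computational_Algebra.Fraction_Field"
    "HOL-Algebra.Algebraic_Closure_Type"
    "Jordan_Normal_Form.Matrix"
begin

text \<open>
  The base field K is a type \<^typ>\<open>'k\<close> and its algebraic closure F is the type
  \<^typ>\<open>'k alg_closure\<close>; K sits in F as \<^term>\<open>range to_ac\<close>. A finite extension of K is a
  subfield of F, and an extension K(x) is presented by its primitive element x.
  The space F^m is \<^term>\<open>carrier_vec m\<close>.
\<close>

section \<open>Simple extensions inside the algebraic closure\<close>

definition is_subfield :: "'a::field set \<Rightarrow> bool" where
  "is_subfield E \<longleftrightarrow> 0 \<in> E \<and> 1 \<in> E \<and>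
     (\<forall>x\<in>E. \<forall>y\<in>E. x - y \<in> E \<and> x * y \<in> E \<and> x / y \<in> E)"

definition adjoin :: "'k::field alg_closure \<Rightarrow> 'k alg_closure set" where
  "adjoin x = is_subfield hull (insert x (range to_ac))"

lemma vector_space_ac:
  "vector_space (\<lambda>(c::'k::field) (x::'k alg_closure). to_ac c * x)"
  by unfold_locales (simp_all add: algebra_simps)

definition ext_degree :: "'k::field alg_closure \<Rightarrow> nat" where
  "ext_degree x = vector_space.dim (\<lambda>c y. to_ac c * y) (adjoin x)"


section \<open>Rational functions\<close>

lemma map_poly_to_ac_mult:
  "map_poly to_ac (p * q) = map_poly to_ac p * map_poly to_ac q"
  by (rule poly_eqI) (simp add: coeff_map_poly Polynomial.coeff_mult to_ac_sum)

lemma map_poly_to_ac_eq_0_iff: "map_poly to_ac p = 0 \<longleftrightarrow> p = 0"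
  by (simp add: poly_eq_iff coeff_map_poly)

text \<open>The inclusion of K(t) into F(t); \<open>rat_to_ac_Fract\<close> shows that it is well defined.\<close>

definition rat_to_ac :: "'k::field poly fract \<Rightarrow> 'k alg_closure poly fract" where
  "rat_to_ac \<phi> =
     (THE \<psi>. \<exists>p q. q \<noteq> 0 \<and> \<phi> = Fract p q \<and>
            \<psi> = Fract (map_poly to_ac p) (map_poly to_ac q))"

lemma rat_to_ac_Fract:
  assumes "q \<noteq> 0"
  shows "rat_to_ac (Fract p q) = Fract (map_poly to_ac p) (map_poly to_ac q)"
  unfolding rat_to_ac_def
proof (rule the_equality)
  show "\<exists>p' q'. q' \<noteq> 0 \<and> Fract p q = Fract p' q' \<and>
          Fract (map_poly to_ac p) (map_poly to_ac q) = Fract (map_poly to_ac p') (map_poly to_ac q')"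
    using assms by blast
next
  fix \<psi>
  assume "\<exists>p' q'. q' \<noteq> 0 \<and> Fract p q = Fract p' q' \<and>
            \<psi> = Fract (map_poly to_ac p') (map_poly to_ac q')"
  then obtain p' q' where *: "q' \<noteq> 0" "Fract p q = Fract p' q'"
    "\<psi> = Fract (map_poly to_ac p') (map_poly to_ac q')"
    by blast
  have "p * q' = p' * q"
    using *(2) eq_fract(1)[OF assms *(1)] by blast
  hence "map_poly to_ac p' * map_poly to_ac q = map_poly to_ac p * map_poly to_ac q'"
    by (simp flip: map_poly_to_ac_mult)
  moreover have "map_poly to_ac q' \<noteq> 0" "map_poly to_ac q \<noteq> 0"
    using *(1) assms map_poly_to_ac_eq_0_iff by blast+
  ultimately show "\<psi> = Fract (map_poly to_ac p) (map_poly to_ac q)"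
    unfolding *(3) using eq_fract(1) by blast
qed

text \<open>
  \<open>rat_value \<phi> t y\<close>: the rational function \<open>\<phi>\<close> over K is defined at the point t of F and
  takes the value y there. The representation p/q need not be the reduced one, but
  \<open>\<phi>\<close> is defined at t iff some representation has a denominator not vanishing at t.
\<close>

definition rat_value :: "'k::field poly fract \<Rightarrow> 'k alg_closure \<Rightarrow> 'k alg_closure \<Rightarrow> bool" where
  "rat_value \<phi> t y \<longleftrightarrow>
     (\<exists>p q. \<phi> = Fract p q \<and> poly (map_poly to_ac q) t \<noteq> 0 \<and>
            y = poly (map_poly to_ac p) t / poly (map_poly to_ac q) t)"

text \<open>The rational function \<open>(a t + b) / (c t + d)\<close> in F(t).\<close>

definition moebius :: "'a::field \<Rightarrow> 'a \<Rightarrow> 'a \<Rightarrow> 'a \<Rightarrow> 'a poly fract" where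
  "moebius a b c d = Fract [:b, a:] [:d, c:]"


section \<open>Zariski topology and degree of affine curves\<close>

inductive polyfun :: "nat \<Rightarrow> ('a::field vec \<Rightarrow> 'a) \<Rightarrow> bool" for m :: nat where
  const: "polyfun m (\<lambda>_. c)"
| coord: "i < m \<Longrightarrow> polyfun m (\<lambda>x. x $ i)"
| add: "polyfun m f \<Longrightarrow> polyfun m g \<Longrightarrow> polyfun m (\<lambda>x. f x + g x)"
| mult: "polyfun m f \<Longrightarrow> polyfun m g \<Longrightarrow> polyfun m (\<lambda>x. f x * g x)"

definition zariski_closed :: "nat \<Rightarrow> 'a::field vec set \<Rightarrow> bool" where
  "zariski_closed m S \<longleftrightarrow>
     (\<exists>P. (\<forall>f\<in>P. polyfun m f) \<and> S = {x \<in> carrier_vec m. \<forall>f\<in>P. f x = 0})"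

text \<open>
  The degree of a curve C in F^m is the number of points in which it meets a general
  hyperplane \<open>c\<^sub>0 x\<^sub>0 + \<dots> + c\<^sub>m\<^sub>-\<^sub>1 x\<^sub>m\<^sub>-\<^sub>1 + c\<^sub>m = 0\<close>, that is, every hyperplane whose coefficient
  vector lies outside the zero set of some nonzero polynomial g. A general hyperplane avoids
  the points at infinity of C, so this is also the degree of the projective closure.
\<close>

definition has_curve_degree :: "nat \<Rightarrow> 'a::field vec set \<Rightarrow> nat \<Rightarrow> bool" where
  "has_curve_degree m C k \<longleftrightarrow>
     (\<exists>g. polyfun (Suc m) g \<and> (\<exists>c\<in>carrier_vec (Suc m). g c \<noteq> 0) \<and>
       (\<forall>c\<in>carrier_vec (Suc m). g c \<noteq> 0 \<longrightarrow>
          finite {x \<in> C. (\<Sum>i<m. c $ i * x $ i) + c $ m = 0} \<and>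
          card {x \<in> C. (\<Sum>i<m. c $ i * x $ i) + c $ m = 0} = k))"

definition curve_degree :: "nat \<Rightarrow> 'a::field vec set \<Rightarrow> nat" where
  "curve_degree m C = (THE k. has_curve_degree m C k)"


section \<open>Hypercircles\<close>

text \<open>
  The components \<open>(\<phi>\<^sub>0, \<dots>, \<phi>\<^sub>n\<^sub>-\<^sub>1)\<close> in K(t) of an element u of K(x)(t), where n = [K(x):K]:
  u is the sum of the \<open>\<phi>\<^sub>i x\<^sup>i\<close>.
\<close>

definition components ::
    "'k::field alg_closure \<Rightarrow> 'k alg_closure poly fract \<Rightarrow> 'k poly fract vec" where
  "components x u =
     (THE \<phi>. \<phi> \<in> carrier_vec (ext_degree x) \<and>
             u = (\<Sum>i<ext_degree x. rat_to_ac (\<phi> $ i) * Fract [:x ^ i:] 1))"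

definition hypercircle ::
    "'k::field alg_closure \<Rightarrow> 'k alg_closure poly fract \<Rightarrow> 'k alg_closure vec set" where
  "hypercircle x u =
     zariski_closed (ext_degree x) hull
       {y \<in> carrier_vec (ext_degree x).
          \<exists>t. \<forall>i<ext_degree x. rat_value (components x u $ i) t (y $ i)}"

definition primitive_hypercircle ::
    "'k::field alg_closure \<Rightarrow> 'k alg_closure vec set \<Rightarrow> bool" where
  "primitive_hypercircle x C \<longleftrightarrow> curve_degree (ext_degree x) C = ext_degree x"

end

(* Writing u(t) = a + e/(t + d) with e = b - a d, an expansion of 1/(t + d) in powers of d with
   coefficients psi_j in K(t) gives u = a + sum_j psi_j e d^j. Expanding a and the elements e d^j
   in powers of alpha over K expresses the components of u as an affine function of the psi_j,
   with coefficients in K. As the e d^j are linearly independent over K, this function has an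
   affine left inverse over K. Hence it matches the parameters at which the two parametrizations
   are defined, and it carries Zariski closures to Zariski closures. *)

theory Submission
  imports Defs
begin

section \<open>Simple extensions\<close>

interpretation ac: vector_space "\<lambda>(c::'k::field) (x::'k alg_closure). to_ac c * x"
  by (rule vector_space_ac)

section \<open>Extension of scalars for polynomials\<close>

lemma map_poly_to_ac_add: "map_poly to_ac (p + q) = map_poly to_ac p + map_poly to_ac q"
  by (rule poly_eqI) (simp add: coeff_map_poly)

lemma map_poly_to_ac_diff: "map_poly to_ac (p - q) = map_poly to_ac p - map_poly to_ac q"
  by (rule poly_eqI) (simp add: coeff_map_poly)

lemma map_poly_to_ac_pCons: "map_poly to_ac (pCons c p) = pCons (to_ac c) (map_poly to_ac p)"
  by (simp add: map_poly_pCons)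

lemma map_poly_to_ac_power: "map_poly to_ac (p ^ n) = map_poly to_ac p ^ n"
  by (induction n) (simp_all add: map_poly_to_ac_mult)

lemma map_poly_to_ac_sum: "map_poly to_ac (\<Sum>i\<in>I. p i) = (\<Sum>i\<in>I. map_poly to_ac (p i))"
  by (rule poly_eqI) (simp add: coeff_map_poly Polynomial.coeff_sum to_ac_sum)

text \<open>Padding with zero coefficients up to n. The alternative \<open>q = 0\<close> matters for
  n = 0, and the disjunction has the shape in which remainders of polynomial division are
  bounded.\<close>

lemma poly_map_poly_to_ac_eq_sum:
  assumes "degree q < n \<or> q = 0"
  shows "poly (map_poly to_ac q) x = (\<Sum>i<n. to_ac (coeff q i) * x ^ i)"
proof -
  have "poly (map_poly to_ac q) x = (\<Sum>i\<le>degree q. to_ac (coeff q i) * x ^ i)"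
    by (simp add: poly_altdef coeff_map_poly degree_map_poly)
  also have "\<dots> = (\<Sum>i<n. to_ac (coeff q i) * x ^ i)"
  proof (cases "q = 0")
    case False
    with assms have "degree q < n" by simp
    thus ?thesis
      by (intro sum.mono_neutral_left) (auto simp: not_le coeff_eq_0)
  qed simp
  finally show ?thesis .
qed

section \<open>Minimal polynomials and the elements of K(x)\<close>

definition minimal_degree_poly :: "'k::field alg_closure \<Rightarrow> 'k poly \<Rightarrow> bool" where
  "minimal_degree_poly x p \<longleftrightarrow> p \<noteq> 0 \<and> poly (map_poly to_ac p) x = 0 \<and>
     (\<forall>q. q \<noteq> 0 \<longrightarrow> poly (map_poly to_ac q) x = 0 \<longrightarrow> degree p \<le> degree q)"

lemma minimal_degree_poly_exists: "\<exists>p. minimal_degree_poly x p"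
proof -
  define P where "P = (\<lambda>p. p \<noteq> 0 \<and> poly (map_poly to_ac p) x = 0)"
  obtain p0 where "P p0"
    unfolding P_def by (rule alg_closure_algebraic[of x]) simp
  then obtain p where "P p" "\<forall>q. P q \<longrightarrow> degree p \<le> degree q"
    using ex_has_least_nat[of P p0 degree] by blast
  thus ?thesis
    unfolding P_def minimal_degree_poly_def by blast
qed

text \<open>As every element of F is algebraic over K, the ring K[x] is closed under inverses: from
  c + y q(y) = 0 with c nonzero, 1/y = -q(y)/c is a polynomial in y, hence in x. Conversely, a
  subfield containing K and x contains all polynomial expressions in x.\<close>

lemma adjoin_eq: "adjoin x = range (\<lambda>q. poly (map_poly to_ac q) x)" (is "_ = ?R")
proof (rule antisym)
  have const: "to_ac c \<in> ?R" for c
    by (rule image_eqI[of _ _ "[:c:]"]) (simp_all add: map_poly_to_ac_pCons)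
  have gen: "x \<in> ?R"
    by (rule image_eqI[of _ _ "[:0, 1:]"]) (simp_all add: map_poly_to_ac_pCons)
  have diff: "y - z \<in> ?R" and add: "y + z \<in> ?R" and mult: "y * z \<in> ?R"
    if "y \<in> ?R" "z \<in> ?R" for y z
  proof -
    from that obtain p q where *: "y = poly (map_poly to_ac p) x" "z = poly (map_poly to_ac q) x"
      by blast
    show "y - z \<in> ?R"
      by (rule image_eqI[of _ _ "p - q"]) (simp_all add: * map_poly_to_ac_diff)
    show "y + z \<in> ?R"
      by (rule image_eqI[of _ _ "p + q"]) (simp_all add: * map_poly_to_ac_add)
    show "y * z \<in> ?R"
      by (rule image_eqI[of _ _ "p * q"]) (simp_all add: * map_poly_to_ac_mult)
  qed
  have poly: "poly (map_poly to_ac q) y \<in> ?R" if "y \<in> ?R" for q y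
  proof (induction q)
    case 0
    show ?case using const[of 0] by simp
  next
    case (pCons c q)
    show ?case
      using add[OF const[of c] mult[OF that pCons.IH]] by (simp add: map_poly_to_ac_pCons)
  qed
  have inverse: "inverse y \<in> ?R" if y: "y \<in> ?R" for y
  proof (cases "y = 0")
    case True
    \<comment> \<open>Here \<open>inverse 0\<close> is 0, so closure under the total operation is
      meant.\<close>
    thus ?thesis using const[of 0] by simp
  next
    case False
    obtain p where p: "minimal_degree_poly y p"
      using minimal_degree_poly_exists by blast
    obtain c q where pq: "p = pCons c q" by (cases p)
    have eq: "to_ac c + y * poly (map_poly to_ac q) y = 0"
      using p by (simp add: minimal_degree_poly_def pq map_poly_to_ac_pCons)
    \<comment> \<open>With zero constant term, y could be cancelled, leaving an annihilating
      polynomial q of smaller degree.\<close>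
    have "c \<noteq> 0"
    proof
      assume c: "c = 0"
      with p pq have "q \<noteq> 0" by (auto simp: minimal_degree_poly_def)
      moreover have "poly (map_poly to_ac q) y = 0" using eq c False by simp
      ultimately have "degree p \<le> degree q" using p by (simp add: minimal_degree_poly_def)
      thus False using \<open>q \<noteq> 0\<close> pq by simp
    qed
    have "inverse y = to_ac (- inverse c) * poly (map_poly to_ac q) y"
      using eq False \<open>c \<noteq> 0\<close> by (simp add: field_simps add_eq_0_iff)
    thus ?thesis by (simp only: mult[OF const poly[OF y]])
  qed
  have "is_subfield ?R"
    unfolding is_subfield_def divide_inverse
    using const[of 0] const[of 1] diff mult inverse by simp
  thus "adjoin x \<subseteq> ?R"
    unfolding adjoin_def using const gen by (intro hull_minimal) auto
next
  show "?R \<subseteq> adjoin x"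
    unfolding adjoin_def hull_def
  proof (safe)
    fix q T
    assume T: "is_subfield T" and sub: "insert x (range to_ac) \<subseteq> T"
    have add: "y + z \<in> T" if "y \<in> T" "z \<in> T" for y z
    proof -
      \<comment> \<open>Subfields are defined by closure under subtraction, so sums are written as
        differences.\<close>
      have "y - (0 - z) \<in> T" using T that unfolding is_subfield_def by blast
      thus ?thesis by simp
    qed
    have mult: "y * z \<in> T" if "y \<in> T" "z \<in> T" for y z
      using T that unfolding is_subfield_def by blast
    show "poly (map_poly to_ac q) x \<in> T"
    proof (induction q)
      case 0
      show ?case using T by (simp add: is_subfield_def)
    next
      case (pCons c q)
      show ?case
        using add[of "to_ac c" "x * poly (map_poly to_ac q) x"] mult[of x] sub pCons.IH
        by (simp add: map_poly_to_ac_pCons image_subset_iff)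
    qed
  qed
qed

lemma is_subfield_adjoin: "is_subfield (adjoin x)"
  unfolding adjoin_def hull_def is_subfield_def by auto

lemma adjoin_minus: "y \<in> adjoin x \<Longrightarrow> z \<in> adjoin x \<Longrightarrow> y - z \<in> adjoin x"
  and adjoin_mult: "y \<in> adjoin x \<Longrightarrow> z \<in> adjoin x \<Longrightarrow> y * z \<in> adjoin x"
  using is_subfield_adjoin[of x] unfolding is_subfield_def by blast+

lemma adjoin_power: "y \<in> adjoin x \<Longrightarrow> y ^ n \<in> adjoin x"
  using is_subfield_adjoin[of x] by (induction n) (auto simp: is_subfield_def)

text \<open>Passes from indexed families to sets. A repetition f i = f j would give a relation with
  coefficients 1 and -1, so the family is injective, and relations on its image can be
  reindexed.\<close>

lemma ac_independent_family:
  fixes f :: "nat \<Rightarrow> 'k::field alg_closure"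
  assumes indep: "\<And>c i. (\<Sum>i<n. to_ac (c i) * f i) = 0 \<Longrightarrow> i < n \<Longrightarrow> c i = 0"
  shows "inj_on f {..<n}" and "ac.independent (f ` {..<n})"
proof -
  show inj: "inj_on f {..<n}"
  proof (rule inj_onI, rule ccontr)
    fix i j assume *: "i \<in> {..<n}" "j \<in> {..<n}" "f i = f j" "i \<noteq> j"
    let ?c = "\<lambda>k. if k = i then 1 else if k = j then -1 else (0::'k)"
    have "(\<Sum>k<n. to_ac (?c k) * f k) = (\<Sum>k\<in>{i,j}. to_ac (?c k) * f k)"
      using * by (intro sum.mono_neutral_right) auto
    also have "\<dots> = 0" using * by simp
    finally have "?c i = 0" using * by (intro indep[of ?c]) auto
    thus False by simp
  qed
  show "ac.independent (f ` {..<n})"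
  proof (rule ac.independent_if_scalars_zero)
    fix g y assume *: "(\<Sum>y\<in>f ` {..<n}. to_ac (g y) * y) = 0" "y \<in> f ` {..<n}"
    have "(\<Sum>i<n. to_ac (g (f i)) * f i) = 0"
      using *(1) by (simp add: sum.reindex[OF inj])
    thus "g y = 0" using indep[of "\<lambda>i. g (f i)"] *(2) by auto
  qed simp
qed

context
  fixes x :: "'k::field alg_closure" and p :: "'k poly"
  assumes p: "minimal_degree_poly x p"
begin

text \<open>The coefficients of a relation form a polynomial of degree below that of p vanishing at
  x, which is zero by minimality.\<close>

lemma sum_lessThan_degree_indep:
  assumes "(\<Sum>i<degree p. to_ac (c i) * x ^ i) = 0" "i < degree p"
  shows "c i = 0"
proof -
  define q where "q = (\<Sum>i<degree p. monom (c i) i)"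
  have coeff: "coeff q j = (if j < degree p then c j else 0)" for j
    by (simp add: q_def Polynomial.coeff_sum)
  have deg: "degree q < degree p"
    using assms(2) by (intro degree_lessI) (auto simp: coeff)
  have "poly (map_poly to_ac q) x = (\<Sum>i<degree p. to_ac (Polynomial.coeff q i) * x ^ i)"
    by (rule poly_map_poly_to_ac_eq_sum[OF disjI1[OF deg]])
  also have "\<dots> = (\<Sum>i<degree p. to_ac (c i) * x ^ i)"
    by (intro sum.cong) (simp_all add: coeff)
  finally have "q = 0"
    using assms(1) deg p by (auto simp: minimal_degree_poly_def not_less[symmetric])
  thus ?thesis using coeff[of i] assms(2) by simp
qed

text \<open>Reduction modulo p does not change the value of a polynomial at x.\<close>

lemma adjoin_eq_sum_lessThan_degree:
  assumes "y \<in> adjoin x"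
  obtains c where "y = (\<Sum>i<degree p. to_ac (c i) * x ^ i)"
proof -
  obtain q where q: "y = poly (map_poly to_ac q) x"
    using assms by (auto simp: adjoin_eq)
  have "y = poly (map_poly to_ac (p * (q div p) + q mod p)) x"
    by (simp add: q)
  also have "\<dots> = poly (map_poly to_ac (q mod p)) x"
    unfolding map_poly_to_ac_add map_poly_to_ac_mult by (use p in \<open>simp add: minimal_degree_poly_def\<close>)
  also have "\<dots> = (\<Sum>i<degree p. to_ac (coeff (q mod p) i) * x ^ i)"
    using degree_mod_less[of p q] p
    by (intro poly_map_poly_to_ac_eq_sum) (auto simp: minimal_degree_poly_def)
  finally show ?thesis by (rule that)
qed

lemma ext_degree_eq_degree: "ext_degree x = degree p"
proof -
  let ?B = "(\<lambda>i. x ^ i) ` {..<degree p}"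
  have inj: "inj_on (\<lambda>i. x ^ i) {..<degree p}"
    by (rule ac_independent_family(1)) (rule sum_lessThan_degree_indep)
  have indep: "ac.independent ?B"
    by (rule ac_independent_family(2)) (rule sum_lessThan_degree_indep)
  have "x \<in> adjoin x" unfolding adjoin_def by (rule hull_inc) simp
  hence "?B \<subseteq> adjoin x" by (auto intro: adjoin_power)
  moreover have "adjoin x \<subseteq> ac.span ?B"
  proof
    fix y assume "y \<in> adjoin x"
    then obtain c where y: "y = (\<Sum>i<degree p. to_ac (c i) * x ^ i)"
      by (rule adjoin_eq_sum_lessThan_degree)
    show "y \<in> ac.span ?B"
      unfolding y by (intro ac.span_sum ac.span_scale ac.span_base) simp
  qed
  moreover have "card ?B = degree p" by (simp add: card_image[OF inj])
  ultimately show ?thesis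
    unfolding ext_degree_def using indep by (intro ac.dim_unique)
qed

end

text \<open>With \<open>adjoin_eq_sum\<close>, this is the power basis of K(x) in terms of
  \<open>ext_degree x\<close> alone, free of the choice of p.\<close>

lemma power_basis_indep:
  fixes x :: "'k::field alg_closure"
  assumes "(\<Sum>i<ext_degree x. to_ac (c i) * x ^ i) = 0" "i < ext_degree x"
  shows "c i = 0"
proof -
  obtain p where p: "minimal_degree_poly x p"
    using minimal_degree_poly_exists by blast
  have deg: "ext_degree x = degree p" by (rule ext_degree_eq_degree[OF p])
  show ?thesis
    by (rule sum_lessThan_degree_indep[OF p assms[unfolded deg]])
qed

lemma adjoin_eq_sum:
  fixes x :: "'k::field alg_closure"
  assumes "y \<in> adjoin x"
  obtains c where "y = (\<Sum>i<ext_degree x. to_ac (c i) * x ^ i)"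
proof -
  obtain p where p: "minimal_degree_poly x p"
    using minimal_degree_poly_exists by blast
  have deg: "ext_degree x = degree p" by (rule ext_degree_eq_degree[OF p])
  show ?thesis
    unfolding deg by (rule adjoin_eq_sum_lessThan_degree[OF p assms]) (rule that[unfolded deg])
qed

text \<open>Multiplication by e preserves independence, so the e d^k extend to a K-basis of F, and
  \<open>l j\<close> is the coordinate at e d^j. Using a basis of all of F makes the functionals
  K-linear without membership conditions.\<close>

lemma scaled_power_dual_functionals:
  fixes d e :: "'k::field alg_closure"
  assumes "e \<noteq> 0"
  shows "\<exists>l :: nat \<Rightarrow> 'k alg_closure \<Rightarrow> 'k.
    (\<forall>j n (c::nat \<Rightarrow> 'k) y. l j (\<Sum>i<n. to_ac (c i) * y i) = (\<Sum>i<n. c i * l j (y i))) \<and>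
    (\<forall>j<ext_degree d. \<forall>k<ext_degree d. l j (e * d ^ k) = (if j = k then 1 else 0))"
proof -
  let ?r = "ext_degree d"
  let ?f = "\<lambda>k. e * d ^ k"
  have indep0: "c i = 0" if "(\<Sum>k<?r. to_ac (c k) * ?f k) = 0" "i < ?r" for c i
  proof -
    have "e * (\<Sum>k<?r. to_ac (c k) * d ^ k) = 0"
      using that(1) by (simp add: sum_distrib_left mult_ac)
    thus ?thesis using power_basis_indep[OF _ that(2)] assms by simp
  qed
  let ?B = "?f ` {..<?r}"
  have inj: "inj_on ?f {..<?r}" by (rule ac_independent_family(1)) (rule indep0)
  have indep: "ac.independent ?B" by (rule ac_independent_family(2)) (rule indep0)
  let ?E = "ac.extend_basis ?B"
  have E: "ac.independent ?E" "ac.span ?E = UNIV" "?B \<subseteq> ?E"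
    using ac.independent_extend_basis[OF indep] ac.span_extend_basis[OF indep]
      ac.extend_basis_superset[OF indep] by simp_all
  define l where "l j y = ac.representation ?E y (?f j)" for j y
  show ?thesis
  proof (intro exI[of _ l] conjI allI impI)
    fix j n and c :: "nat \<Rightarrow> 'k" and y
    show "l j (\<Sum>i<n. to_ac (c i) * y i) = (\<Sum>i<n. c i * l j (y i))"
      by (simp add: l_def E(1,2) ac.representation_sum ac.representation_scale)
  next
    fix j k assume *: "j < ?r" "k < ?r"
    have "ac.representation ?E (?f k) = (\<lambda>v. if v = ?f k then 1 else 0)"
      using E(1,3) * by (intro ac.representation_basis) auto
    moreover have "?f j = ?f k \<longleftrightarrow> j = k"
      using inj_on_eq_iff[OF inj, of j k] * by blast
    ultimately show "l j (?f k) = (if j = k then 1 else 0)"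
      by (simp only: l_def)
  qed
qed


section \<open>Rational functions\<close>

text \<open>Names the factors \<open>Fract [:x ^ i:] 1\<close> of \<open>components\<close>, so that
  constants over K and over F can be treated by homomorphism laws.\<close>

definition const_fract :: "'a::field \<Rightarrow> 'a poly fract" where
  "const_fract c = Fract [:c:] 1"

lemma const_fract_add: "const_fract (x + y) = const_fract x + const_fract y"
  by (simp add: const_fract_def)

lemma const_fract_mult: "const_fract (x * y) = const_fract x * const_fract y"
  by (simp add: const_fract_def mult.commute)

lemma const_fract_sum: "const_fract (\<Sum>i\<in>I. f i) = (\<Sum>i\<in>I. const_fract (f i))"
  by (induction I rule: infinite_finite_induct)
     (simp_all add: const_fract_add, simp_all add: const_fract_def fract_collapse)

lemma Fract_1_sum: "Fract (\<Sum>i\<in>I. f i) 1 = (\<Sum>i\<in>I. Fract (f i) 1)"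
proof (induction I rule: infinite_finite_induct)
  case (insert i I)
  have "Fract (f i + (\<Sum>i\<in>I. f i)) 1 = Fract (f i) 1 + Fract (\<Sum>i\<in>I. f i) 1" by simp
  with insert show ?case by simp
qed (simp_all add: fract_collapse)

lemma rat_to_ac_add: "rat_to_ac (\<phi> + \<psi>) = rat_to_ac \<phi> + rat_to_ac \<psi>"
proof (cases \<phi>; cases \<psi>)
  fix p q p' q' assume *: "\<phi> = Fract p q" "q \<noteq> 0" "\<psi> = Fract p' q'" "q' \<noteq> 0"
  thus ?thesis
    by (simp add: rat_to_ac_Fract map_poly_to_ac_add map_poly_to_ac_mult map_poly_to_ac_eq_0_iff)
qed

lemma rat_to_ac_mult: "rat_to_ac (\<phi> * \<psi>) = rat_to_ac \<phi> * rat_to_ac \<psi>"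
proof (cases \<phi>; cases \<psi>)
  fix p q p' q' assume *: "\<phi> = Fract p q" "q \<noteq> 0" "\<psi> = Fract p' q'" "q' \<noteq> 0"
  thus ?thesis
    by (simp add: rat_to_ac_Fract map_poly_to_ac_mult map_poly_to_ac_eq_0_iff)
qed

lemma rat_to_ac_const: "rat_to_ac (const_fract c) = const_fract (to_ac c)"
  by (simp add: const_fract_def rat_to_ac_Fract map_poly_to_ac_pCons)

lemma rat_to_ac_0: "rat_to_ac 0 = 0"
  by (simp add: Zero_fract_def rat_to_ac_Fract)

lemma rat_to_ac_sum: "rat_to_ac (\<Sum>i\<in>I. f i) = (\<Sum>i\<in>I. rat_to_ac (f i))"
  by (induction I rule: infinite_finite_induct) (simp_all add: rat_to_ac_0 rat_to_ac_add)

lemma rat_to_ac_diff: "rat_to_ac (\<phi> - \<psi>) = rat_to_ac \<phi> - rat_to_ac \<psi>"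
  using rat_to_ac_add[of "\<phi> - \<psi>" \<psi>] by (simp add: algebra_simps)

section \<open>Expansions over K(t) in powers of an algebraic element\<close>

lemma common_denominator:
  fixes f :: "nat \<Rightarrow> 'a::idom fract"
  shows "\<exists>q p. q \<noteq> 0 \<and> (\<forall>i<n. f i = Fract (p i) q)"
proof (induction n)
  case 0
  show ?case by (rule exI[of _ 1]) simp
next
  case (Suc n)
  then obtain q p where qp: "q \<noteq> 0" "\<And>i. i < n \<Longrightarrow> f i = Fract (p i) q" by blast
  obtain p' q' where *: "f n = Fract p' q'" "q' \<noteq> 0" by (cases "f n")
  show ?case
  proof (intro exI conjI allI impI)
    show "q * q' \<noteq> 0" using qp * by simp
    fix i assume i: "i < Suc n"
    show "f i = Fract (if i = n then q * p' else q' * p i) (q * q')"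
    proof (cases "i = n")
      case True
      thus ?thesis using qp(1) * by (simp add: mult_fract_cancel)
    next
      case False
      with i have "f i = Fract (p i) q" by (intro qp(2)) simp
      thus ?thesis using False * by (simp add: mult_fract_cancel mult.commute[of q q'])
    qed
  qed
qed

text \<open>Clearing a common denominator leaves a relation between polynomials in t. Its
  coefficient at each power of t is a relation over K between the powers of x, hence
  trivial.\<close>

lemma rat_power_basis_indep:
  fixes x :: "'k::field alg_closure"
  assumes "(\<Sum>i<ext_degree x. rat_to_ac (f i) * const_fract (x ^ i)) = 0" "i < ext_degree x"
  shows "f i = 0"
proof -
  let ?n = "ext_degree x"
  obtain p q where q: "q \<noteq> 0" and f: "\<And>i. i < ?n \<Longrightarrow> f i = Fract (p i) q"
    using common_denominator[of ?n f] by blast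
  let ?q = "map_poly to_ac q :: 'k alg_closure poly"
  have nz: "?q \<noteq> 0" using q by (simp add: map_poly_to_ac_eq_0_iff)
  have "Fract (\<Sum>i<?n. map_poly to_ac (p i) * [:x ^ i:]) 1
      = (\<Sum>i<?n. Fract ?q 1 * (rat_to_ac (f i) * const_fract (x ^ i)))"
    unfolding Fract_1_sum
    by (intro sum.cong) (use nz in \<open>simp_all add: f rat_to_ac_Fract q const_fract_def eq_fract mult.commute[of ?q]\<close>)
  also have "\<dots> = 0" using assms(1) by (simp flip: sum_distrib_left)
  finally have eq: "(\<Sum>i<?n. map_poly to_ac (p i) * [:x ^ i:]) = 0"
    by (simp add: Zero_fract_def eq_fract)
  have "coeff (p i) k = 0" for k
  proof (rule power_basis_indep[OF _ assms(2)])
    have "0 = coeff (\<Sum>i<?n. map_poly to_ac (p i) * [:x ^ i:]) k"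
      unfolding eq by simp
    thus "(\<Sum>i<?n. to_ac (coeff (p i) k) * x ^ i) = 0"
      by (simp add: Polynomial.coeff_sum coeff_map_poly mult.commute)
  qed
  hence "p i = 0" by (simp add: poly_eq_iff)
  thus ?thesis using f[OF assms(2)] by (simp add: fract_collapse)
qed

text \<open>The difference of two expansions is a relation over K(t), which is trivial; this
  uniqueness justifies the definite description in \<open>components\<close>.\<close>

lemma components_eqI:
  fixes \<phi> :: "'k::field poly fract vec"
  assumes "\<phi> \<in> carrier_vec (ext_degree x)"
    and "u = (\<Sum>i<ext_degree x. rat_to_ac (\<phi> $ i) * const_fract (x ^ i))"
  shows "components x u = \<phi>"
  unfolding components_def const_fract_def[symmetric]
proof (rule the_equality)
  fix \<psi> assume \<psi>: "\<psi> \<in> carrier_vec (ext_degree x) \<and>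
    u = (\<Sum>i<ext_degree x. rat_to_ac (\<psi> $ i) * const_fract (x ^ i))"
  have "(\<Sum>i<ext_degree x. rat_to_ac (\<psi> $ i - \<phi> $ i) * const_fract (x ^ i)) = u - u"
    using \<psi> assms(2) by (simp add: rat_to_ac_diff left_diff_distrib sum_subtractf)
  hence "\<psi> $ i - \<phi> $ i = 0" if "i < ext_degree x" for i
    using rat_power_basis_indep[of "\<lambda>i. \<psi> $ i - \<phi> $ i" x, OF _ that] by simp
  thus "\<psi> = \<phi>" using \<psi> assms(1) by (intro eq_vecI) auto
qed (use assms in blast)

text \<open>With \<open>p\<close> a polynomial over K of degree [K(d):K] vanishing at \<open>d\<close>, the polynomial
  \<open>p(d) - p(-t)\<close> is \<open>t + d\<close> times a polynomial in \<open>d\<close> over K[t], so that dividing by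
  \<open>-p(-t)\<close> expands \<open>1/(t + d)\<close> in powers of \<open>d\<close>.\<close>

lemma inverse_linear_expansion:
  fixes d :: "'k::field alg_closure"
  obtains \<psi> where
    "Fract 1 [:d, 1:] = (\<Sum>j<ext_degree d. rat_to_ac (\<psi> j) * const_fract (d ^ j))"
proof -
  obtain p where "minimal_degree_poly d p"
    using minimal_degree_poly_exists by blast
  hence p: "p \<noteq> 0" "poly (map_poly to_ac p) d = 0" "degree p = ext_degree d"
    by (simp_all add: minimal_degree_poly_def ext_degree_eq_degree)
  define r where "r = ext_degree d"
  have deg: "degree p = r" by (simp add: r_def p)
  have "r \<noteq> 0"
  proof
    assume "r = 0"
    with deg obtain c where "p = [:c:]" by (auto elim: degree_eq_zeroE)
    with p show False by (simp add: map_poly_to_ac_pCons)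
  qed
  \<comment> \<open>This is -t. Below, \<open>q\<close> is p(-t), and \<open>R j\<close> is the
    coefficient of X^j in (p(X) - p(-t)) / (X + t).\<close>
  let ?s = "[:0, -1:]"
  define q where "q = (\<Sum>i\<le>r. [:coeff p i:] * ?s ^ i)"
  define R where "R j = (\<Sum>i=Suc j..r. [:coeff p i:] * ?s ^ (i - j - 1))" for j
  have "q = p \<circ>\<^sub>p ?s"
    by (simp add: q_def pcompose_altdef poly_altdef coeff_map_poly degree_map_poly deg)
  hence q: "q \<noteq> 0" using p(1) by (simp add: pcompose_eq_0_iff)
  let ?Q = "map_poly to_ac q" and ?R = "\<lambda>j. map_poly to_ac (R j)"
  have mapQ: "?Q = (\<Sum>i\<le>r. [:to_ac (coeff p i):] * ?s ^ i)"
    and mapR: "?R j = (\<Sum>i=Suc j..r. [:to_ac (coeff p i):] * ?s ^ (i - j - 1))" for j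
    by (simp_all add: q_def R_def map_poly_to_ac_sum map_poly_to_ac_mult map_poly_to_ac_power
        map_poly_to_ac_pCons del: mult_pCons_left mult_pCons_right)
  have "(\<Sum>i\<le>r. [:to_ac (coeff p i):] * [:d:] ^ i) = [:poly (map_poly to_ac p) d:]"
    unfolding poly_altdef by (simp add: coeff_map_poly degree_map_poly deg poly_const_pow
        mult.commute flip: sum_to_poly)
  \<comment> \<open>The standard factorization of p(d) - p(-t) by d - (-t), where p(d) = 0. It asks
    for a positive degree bound, which is why r was shown to be nonzero.\<close>
  hence "- ?Q = ([:d:] - ?s) * (\<Sum>j<r. ?R j * [:d:] ^ j)"
    using polyfun_diff[of r "\<lambda>i. [:to_ac (coeff p i):]" "[:d:]" ?s] \<open>r \<noteq> 0\<close>
    unfolding mapQ mapR p(2) by simp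
  hence eq: "- ?Q = (\<Sum>j<r. ?R j * [:d ^ j:]) * [:d, 1:]"
    by (simp add: poly_const_pow mult.commute)
  have nz: "?Q \<noteq> 0" using q by (simp add: map_poly_to_ac_eq_0_iff)
  have "Fract 1 [:d, 1:] = Fract (\<Sum>j<r. ?R j * [:d ^ j:]) (- ?Q)"
    using eq nz by (subst eq_fract) auto
  also have "\<dots> = Fract 1 (- ?Q) * Fract (\<Sum>j<r. ?R j * [:d ^ j:]) 1"
    by simp
  also have "\<dots> = (\<Sum>j<r. rat_to_ac (Fract (R j) (- q)) * const_fract (d ^ j))"
    unfolding Fract_1_sum sum_distrib_left
    using map_poly_to_ac_diff[of 0 q]
    by (intro sum.cong) (use q in \<open>simp_all add: rat_to_ac_Fract const_fract_def\<close>)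
  finally show ?thesis by (intro that) (simp add: r_def)
qed

section \<open>Values of rational functions at points of F\<close>

lemma rat_value_unique:
  assumes "rat_value \<phi> t y" "rat_value \<phi> t z"
  shows "y = z"
proof -
  obtain p q p' q' where *: "\<phi> = Fract p q" "poly (map_poly to_ac q) t \<noteq> 0"
      "y = poly (map_poly to_ac p) t / poly (map_poly to_ac q) t"
      "\<phi> = Fract p' q'" "poly (map_poly to_ac q') t \<noteq> 0"
      "z = poly (map_poly to_ac p') t / poly (map_poly to_ac q') t"
    using assms unfolding rat_value_def by blast
  have "q \<noteq> 0" "q' \<noteq> 0" using * by auto
  \<comment> \<open>Equality of the fractions is a polynomial identity, which can be evaluated at t
    whether or not the fractions are reduced.\<close>
  hence "p * q' = p' * q" using * eq_fract by metis
  hence "poly (map_poly to_ac (p * q')) t = poly (map_poly to_ac (p' * q)) t" by simp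
  thus ?thesis using *(2,5) unfolding *(3,6) by (simp add: map_poly_to_ac_mult frac_eq_eq)
qed

lemma rat_value_const: "rat_value (const_fract c) t (to_ac c)"
  unfolding rat_value_def const_fract_def
  by (intro exI[of _ "[:c:]"] exI[of _ 1]) (simp add: map_poly_to_ac_pCons)

lemma rat_value_add:
  assumes "rat_value \<phi> t y" "rat_value \<psi> t z"
  shows "rat_value (\<phi> + \<psi>) t (y + z)"
proof -
  obtain p q p' q' where *: "\<phi> = Fract p q" "poly (map_poly to_ac q) t \<noteq> 0"
      "y = poly (map_poly to_ac p) t / poly (map_poly to_ac q) t"
      "\<psi> = Fract p' q'" "poly (map_poly to_ac q') t \<noteq> 0"
      "z = poly (map_poly to_ac p') t / poly (map_poly to_ac q') t"
    using assms unfolding rat_value_def by blast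
  have "q \<noteq> 0" "q' \<noteq> 0" using * by auto
  thus ?thesis unfolding rat_value_def using *
    by (intro exI[of _ "p * q' + p' * q"] exI[of _ "q * q'"])
       (simp add: map_poly_to_ac_add map_poly_to_ac_mult add_frac_eq)
qed

lemma rat_value_mult:
  assumes "rat_value \<phi> t y" "rat_value \<psi> t z"
  shows "rat_value (\<phi> * \<psi>) t (y * z)"
proof -
  obtain p q p' q' where *: "\<phi> = Fract p q" "poly (map_poly to_ac q) t \<noteq> 0"
      "y = poly (map_poly to_ac p) t / poly (map_poly to_ac q) t"
      "\<psi> = Fract p' q'" "poly (map_poly to_ac q') t \<noteq> 0"
      "z = poly (map_poly to_ac p') t / poly (map_poly to_ac q') t"
    using assms unfolding rat_value_def by blast
  thus ?thesis unfolding rat_value_def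
    by (intro exI[of _ "p * p'"] exI[of _ "q * q'"]) (simp add: map_poly_to_ac_mult)
qed

lemma rat_value_sum:
  assumes "finite I" "\<And>i. i \<in> I \<Longrightarrow> rat_value (f i) t (y i)"
  shows "rat_value (\<Sum>i\<in>I. f i) t (\<Sum>i\<in>I. y i)"
  using assms
proof (induction I)
  case empty
  show ?case using rat_value_const[of 0 t] by (simp add: const_fract_def fract_collapse)
qed (simp add: rat_value_add)


section \<open>Zariski closures\<close>

lemma polyfun_compose:
  fixes T :: "'a::field vec \<Rightarrow> 'a vec"
  assumes "polyfun n f" "\<And>i. i < n \<Longrightarrow> polyfun m (\<lambda>x. T x $ i)"
  shows "polyfun m (\<lambda>x. f (T x))"
  using assms by (induction f) (auto intro: polyfun.intros)

lemma polyfun_sum: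
  assumes "finite I" "\<And>i. i \<in> I \<Longrightarrow> polyfun m (f i)"
  shows "polyfun m (\<lambda>x. \<Sum>i\<in>I. f i x)"
  using assms by (induction I) (auto intro: polyfun.intros)

lemma polyfun_minus:
  assumes "polyfun m f" "polyfun m g"
  shows "polyfun m (\<lambda>x. f x - g x)"
  using polyfun.add[OF assms(1) polyfun.mult[OF polyfun.const[of _ "-1"] assms(2)]] by simp

text \<open>The common zero set of all polynomials vanishing on S is closed, and the equations of
  any closed set containing S are among these polynomials.\<close>

lemma zariski_hull_eq:
  assumes "S \<subseteq> carrier_vec m"
  shows "zariski_closed m hull S =
    {x \<in> carrier_vec m. \<forall>f. polyfun m f \<longrightarrow> (\<forall>s\<in>S. f s = 0) \<longrightarrow> f x = 0}" (is "_ = ?H")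
proof (rule hull_unique)
  show "S \<subseteq> ?H" using assms by auto
  show "zariski_closed m ?H"
    unfolding zariski_closed_def
    by (rule exI[of _ "{f. polyfun m f \<and> (\<forall>s\<in>S. f s = 0)}"]) auto
  show "?H \<subseteq> S'" if "S \<subseteq> S'" "zariski_closed m S'" for S'
    using that unfolding zariski_closed_def by blast
qed

text \<open>A polynomial map with a polynomial left inverse is a closed embedding. Pulling equations
  back along T gives one inclusion. For the other, the coordinates of T (L y) - y vanish on the
  image of S, hence on its closure, which therefore lies in the image of T; pulling back along L
  then puts L y into the closure of S.\<close>

lemma zariski_hull_image:
  fixes T L :: "'a::field vec \<Rightarrow> 'a vec"
  assumes S: "S \<subseteq> carrier_vec m"
    and T: "\<And>x. T x \<in> carrier_vec n" "\<And>i. i < n \<Longrightarrow> polyfun m (\<lambda>x. T x $ i)"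
    and L: "\<And>y. L y \<in> carrier_vec m" "\<And>i. i < m \<Longrightarrow> polyfun n (\<lambda>y. L y $ i)"
    and inv: "\<And>x. x \<in> carrier_vec m \<Longrightarrow> L (T x) = x"
  shows "T ` (zariski_closed m hull S) = zariski_closed n hull (T ` S)"
proof -
  have TS: "T ` S \<subseteq> carrier_vec n" using T(1) by blast
  show ?thesis
  proof (rule antisym)
    show "T ` (zariski_closed m hull S) \<subseteq> zariski_closed n hull (T ` S)"
      unfolding zariski_hull_eq[OF S] zariski_hull_eq[OF TS]
    proof (safe, goal_cases)
      case (1 x)
      show ?case by (rule T(1))
    next
      case (2 y x f)
      thus ?case using polyfun_compose[of n f m T] T(2) by blast
    qed
    show "zariski_closed n hull (T ` S) \<subseteq> T ` (zariski_closed m hull S)"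
    proof
      fix y assume "y \<in> zariski_closed n hull (T ` S)"
      hence y: "y \<in> carrier_vec n"
        and vanish: "\<And>f. polyfun n f \<Longrightarrow> (\<And>s. s \<in> S \<Longrightarrow> f (T s) = 0) \<Longrightarrow> f y = 0"
        unfolding zariski_hull_eq[OF TS] by auto
      have "T (L y) $ i - y $ i = 0" if "i < n" for i
      proof (rule vanish)
        show "polyfun n (\<lambda>y. T (L y) $ i - y $ i)"
          using that polyfun_compose[OF T(2) L(2)]
          by (intro polyfun_minus polyfun.coord) auto
        show "T (L (T s)) $ i - T s $ i = 0" if "s \<in> S" for s
          using that S inv by auto
      qed
      hence "y = T (L y)" using y T(1)[of "L y"] by (intro eq_vecI) auto
      moreover have "L y \<in> zariski_closed m hull S"
        unfolding zariski_hull_eq[OF S]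
      proof (safe, goal_cases)
        case 1
        show ?case by (rule L(1))
      next
        case (2 f)
        show ?case
        proof (rule vanish)
          show "polyfun n (\<lambda>y. f (L y))" using polyfun_compose[OF 2(1) L(2)] .
          show "f (L (T s)) = 0" if "s \<in> S" for s
            using that S inv 2(2) by auto
        qed
      qed
      ultimately show "y \<in> T ` (zariski_closed m hull S)" by blast
    qed
  qed
qed


section \<open>The affine inclusion\<close>

text \<open>Division of a t + b by t + d, with remainder b - a d.\<close>

lemma moebius_1_eq:
  "moebius a b 1 d = const_fract a + const_fract (b - a * d) * Fract 1 [:d, 1:]"
  by (simp add: moebius_def const_fract_def eq_fract algebra_simps)

text \<open>Exchanging the sums applies row j of a product of matrices to x. Working over a
  commutative ring covers both vectors over F and vectors of rational functions.\<close>

lemma left_inverse_apply: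
  fixes m :: "nat \<Rightarrow> nat \<Rightarrow> 'a::comm_ring_1"
  assumes "\<And>k. k < r \<Longrightarrow> (\<Sum>i<n. b i * m k i) = (if j = k then 1 else 0)" "j < r"
  shows "(\<Sum>i<n. b i * (\<Sum>k<r. m k i * x k)) = x j"
proof -
  have "(\<Sum>i<n. b i * (\<Sum>k<r. m k i * x k)) = (\<Sum>k<r. (\<Sum>i<n. b i * m k i) * x k)"
    unfolding sum_distrib_left sum_distrib_right by (subst sum.swap) (simp add: mult_ac)
  also have "\<dots> = (\<Sum>k<r. if j = k then x k else 0)"
    using assms(1) by (intro sum.cong) auto
  finally show ?thesis using assms(2) by simp
qed

theorem theorem3p6:
  fixes \<alpha> a b d :: "'k::field_char_0 alg_closure"
    and n r :: nat
    and U V :: "'k alg_closure vec set"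
  assumes n: "n = ext_degree \<alpha>"
    and coeffs: "a \<in> adjoin \<alpha>" "b \<in> adjoin \<alpha>" "d \<in> adjoin \<alpha>"
    and unit: "a * d - b \<noteq> 0"
    and U: "U = hypercircle \<alpha> (moebius a b 1 d)"
    and non_primitive: "\<not> primitive_hypercircle \<alpha> U"
    and r: "r = ext_degree d"
    and V: "V = hypercircle d (moebius 0 1 1 d)"
  shows "\<exists>(A :: 'k mat) (v :: 'k vec). A \<in> carrier_mat n r \<and> v \<in> carrier_vec n \<and>
           inj_on (\<lambda>x. map_mat to_ac A *\<^sub>v x + map_vec to_ac v) (carrier_vec r) \<and>
           (\<lambda>x. map_mat to_ac A *\<^sub>v x + map_vec to_ac v) ` V = U"
proof -

  \<comment> \<open>Coordinates over K and a left inverse matrix\<close>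
  define e where "e = b - a * d"
  have "e \<noteq> 0" using unit by (simp add: e_def)
  obtain v where v: "a = (\<Sum>i<n. to_ac (v i) * \<alpha> ^ i)"
    using adjoin_eq_sum[OF coeffs(1)] unfolding n by blast
  have "e * d ^ j \<in> adjoin \<alpha>" for j
    unfolding e_def using coeffs by (intro adjoin_mult adjoin_minus adjoin_power)
  hence "\<exists>c. e * d ^ j = (\<Sum>i<n. to_ac (c i) * \<alpha> ^ i)" for j
    unfolding n by (rule adjoin_eq_sum) blast
  \<comment> \<open>The first index of \<open>M\<close> is the column: \<open>M j\<close> lists the
    coordinates of e d^j in powers of \<alpha>.\<close>
  then obtain M where M: "\<And>j. e * d ^ j = (\<Sum>i<n. to_ac (M j i) * \<alpha> ^ i)" by metis
  obtain l :: "nat \<Rightarrow> 'k alg_closure \<Rightarrow> 'k"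
    where l: "(\<forall>j n (c::nat \<Rightarrow> 'k) y. l j (\<Sum>i<n. to_ac (c i) * y i) = (\<Sum>i<n. c i * l j (y i))) \<and>
      (\<forall>j<r. \<forall>k<r. l j (e * d ^ k) = (if j = k then 1 else 0))"
    using scaled_power_dual_functionals[OF \<open>e \<noteq> 0\<close>, of d, folded r] by (rule exE)
  note l_sum = conjunct1[OF l] and l_dual = conjunct2[OF l]
  \<comment> \<open>the matrix of a K-linear left inverse of the map with matrix \<open>M\<close>\<close>
  define B where "B j i = l j (\<alpha> ^ i)" for j i
  \<comment> \<open>Applying the K-linear \<open>l j\<close> to the expansion of e d^k gives the
    entry (j, k) of the matrix product.\<close>
  have BM: "(\<Sum>i<n. B j i * M k i) = (if j = k then 1 else 0)" if "j < r" "k < r" for j k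
  proof -
    have "l j (e * d ^ k) = (\<Sum>i<n. B j i * M k i)"
      unfolding M l_sum[rule_format] B_def by (simp add: mult.commute)
    thus ?thesis using l_dual that by simp
  qed

  \<comment> \<open>The components of the two units\<close>
  obtain \<psi> where \<psi>: "Fract 1 [:d, 1:] = (\<Sum>j<r. rat_to_ac (\<psi> j) * const_fract (d ^ j))"
    using inverse_linear_expansion[of d] unfolding r by blast
  \<comment> \<open>The coefficient of \<alpha>^i in a + e/(t + d), once a and all e d^j are
    expanded in powers of \<alpha>.\<close>
  define \<Phi> where "\<Phi> i = (\<Sum>j<r. const_fract (M j i) * \<psi> j) + const_fract (v i)" for i
  have comp_V: "components d (moebius 0 1 1 d) = vec r \<psi>"
    by (rule components_eqI) (use \<psi> in \<open>simp_all add: moebius_def r one_pCons\<close>)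
  have comp_U: "components \<alpha> (moebius a b 1 d) = vec n \<Phi>"
  proof (rule components_eqI)
    have "const_fract e * Fract 1 [:d, 1:] = (\<Sum>j<r. rat_to_ac (\<psi> j) * const_fract (e * d ^ j))"
      unfolding \<psi> sum_distrib_left by (simp add: const_fract_mult mult_ac)
    also have "\<dots> = (\<Sum>j<r. \<Sum>i<n. rat_to_ac (\<psi> j) * (const_fract (to_ac (M j i)) * const_fract (\<alpha> ^ i)))"
      unfolding M const_fract_sum const_fract_mult sum_distrib_left ..
    also have "\<dots> = (\<Sum>i<n. rat_to_ac (\<Sum>j<r. const_fract (M j i) * \<psi> j) * const_fract (\<alpha> ^ i))"
      unfolding rat_to_ac_sum rat_to_ac_mult rat_to_ac_const sum_distrib_right
      by (subst sum.swap) (simp add: mult_ac)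
    finally show "moebius a b 1 d =
        (\<Sum>i<ext_degree \<alpha>. rat_to_ac (vec n \<Phi> $ i) * const_fract (\<alpha> ^ i))"
      unfolding moebius_1_eq e_def[symmetric]
      by (subst v) (simp add: const_fract_sum const_fract_mult \<Phi>_def rat_to_ac_add
          rat_to_ac_const distrib_right sum.distrib add.commute flip: n)
  qed (simp add: n)

  \<comment> \<open>The affine map and its left inverse\<close>
  define T where "T x = vec n (\<lambda>i. (\<Sum>j<r. to_ac (M j i) * x $ j) + to_ac (v i))"
    for x :: "'k alg_closure vec"
  \<comment> \<open>Undoes the translation, then applies the left inverse matrix
    \<open>B\<close>.\<close>
  define L where "L y = vec r (\<lambda>j. \<Sum>i<n. to_ac (B j i) * (y $ i - to_ac (v i)))"
    for y :: "'k alg_closure vec"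
  have T_carrier: "T x \<in> carrier_vec n" and L_carrier: "L x \<in> carrier_vec r" for x
    by (simp_all add: T_def L_def)
  have T_index: "T x $ i = (\<Sum>j<r. to_ac (M j i) * x $ j) + to_ac (v i)" if "i < n" for x i
    using that by (simp add: T_def)
  have L_index: "L y $ j = (\<Sum>i<n. to_ac (B j i) * (y $ i - to_ac (v i)))" if "j < r" for y j
    using that by (simp add: L_def)
  have LT: "L (T x) = x" if "x \<in> carrier_vec r" for x
  proof (rule eq_vecI)
    fix j assume "j < dim_vec x"
    hence j: "j < r" using that by simp
    have "L (T x) $ j = (\<Sum>i<n. to_ac (B j i) * (\<Sum>k<r. to_ac (M k i) * x $ k))"
      using j by (simp add: L_index T_index)
    also have "\<dots> = x $ j"
    proof (rule left_inverse_apply[OF _ j])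
      show "(\<Sum>i<n. to_ac (B j i) * to_ac (M k i)) = (if j = k then 1 else 0)" if "k < r" for k
        using arg_cong[OF BM[OF j that], of to_ac] by (simp add: to_ac_sum)
    qed
    finally show "L (T x) $ j = x $ j" .
  qed (use that L_carrier[of "T x"] in auto)

  \<comment> \<open>The parametrized points and their closures\<close>
  define SV where "SV = {x \<in> carrier_vec r. \<exists>t. \<forall>j<r. rat_value (\<psi> j) t (x $ j)}"
  define SU where "SU = {y \<in> carrier_vec n. \<exists>t. \<forall>i<n. rat_value (\<Phi> i) t (y $ i)}"
  have rat_T: "rat_value (\<Phi> i) t (T x $ i)"
    if "\<And>j. j < r \<Longrightarrow> rat_value (\<psi> j) t (x $ j)" "i < n" for t i and x :: "'k alg_closure vec"
    unfolding \<Phi>_def T_index[OF that(2)] using that(1)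
    by (intro rat_value_add rat_value_sum rat_value_mult rat_value_const) auto
  \<comment> \<open>Since \<open>\<psi>\<close> is \<open>B\<close> applied to \<open>\<Phi>\<close>
    minus \<open>v\<close>, every \<open>\<psi> j\<close> is defined wherever all
    \<open>\<Phi> i\<close> are: no parameter t is lost in passing back from U to V.\<close>
  have rat_L: "rat_value (\<psi> j) t (L y $ j)"
    if "\<And>i. i < n \<Longrightarrow> rat_value (\<Phi> i) t (y $ i)" and j: "j < r" for t j and y :: "'k alg_closure vec"
  proof -
    have "\<psi> j = (\<Sum>i<n. const_fract (B j i) * (\<Sum>k<r. const_fract (M k i) * \<psi> k))"
    proof (rule left_inverse_apply[OF _ j, symmetric])
      show "(\<Sum>i<n. const_fract (B j i) * const_fract (M k i)) = (if j = k then 1 else 0)"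
        if "k < r" for k
        using arg_cong[OF BM[OF j that], of const_fract]
        by (simp add: const_fract_sum const_fract_mult)
          (simp add: const_fract_def fract_collapse one_pCons[symmetric])
    qed
    also have "\<dots> = (\<Sum>i<n. const_fract (B j i) * (\<Phi> i + const_fract (- v i)))"
      by (simp add: \<Phi>_def add.assoc flip: const_fract_add)
        (simp add: const_fract_def fract_collapse)
    finally show ?thesis
      using rat_value_add[OF that(1) rat_value_const[of "- v _" t]]
      by (simp only: L_index[OF j], intro rat_value_sum rat_value_mult rat_value_const) simp_all
  qed
  have "T ` SV = SU"
  proof (rule antisym)
    show "T ` SV \<subseteq> SU" using rat_T T_carrier unfolding SV_def SU_def by blast
    show "SU \<subseteq> T ` SV"
    proof
      fix y assume "y \<in> SU"
      then obtain t where y: "y \<in> carrier_vec n" and t: "\<And>i. i < n \<Longrightarrow> rat_value (\<Phi> i) t (y $ i)"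
        unfolding SU_def by blast
      \<comment> \<open>Both sides have as coordinates the values of the \<open>\<Phi> i\<close> at
        the same t, and values are unique.\<close>
      have "T (L y) = y"
      proof (rule eq_vecI)
        fix i assume "i < dim_vec y"
        hence i: "i < n" using y by simp
        show "T (L y) $ i = y $ i"
          by (rule rat_value_unique[OF rat_T[OF rat_L[OF t] i] t[OF i]])
      qed (use y T_carrier[of "L y"] in auto)
      moreover have "L y \<in> SV" unfolding SV_def using rat_L[OF t] L_carrier by blast
      ultimately show "y \<in> T ` SV" by force
    qed
  qed
  moreover have SV: "SV \<subseteq> carrier_vec r" by (auto simp: SV_def)
  have "T ` (zariski_closed r hull SV) = zariski_closed n hull (T ` SV)"
  proof (rule zariski_hull_image[OF SV])
    show "polyfun r (\<lambda>x. T x $ i)" if "i < n" for i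
      unfolding T_index[OF that]
      by (intro polyfun.add polyfun_sum polyfun.mult polyfun.const polyfun.coord) auto
    show "polyfun n (\<lambda>y. L y $ j)" if "j < r" for j
      unfolding L_index[OF that]
      by (intro polyfun_sum polyfun_minus polyfun.mult polyfun.const polyfun.coord) auto
  qed (use T_carrier L_carrier LT in auto)
  moreover have V_eq: "V = zariski_closed r hull SV"
    unfolding V hypercircle_def comp_V r[symmetric] SV_def by (rule arg_cong) auto
  moreover have "U = zariski_closed n hull SU"
    unfolding U hypercircle_def comp_U n[symmetric] SU_def by (rule arg_cong) auto
  ultimately have TV: "T ` V = U" by simp
  \<comment> \<open>The matrix form of the map is compared with \<open>T\<close> only on vectors of
    dimension r.\<close>
  have V_sub: "V \<subseteq> carrier_vec r"
    unfolding V_eq zariski_hull_eq[OF SV] by blast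

  \<comment> \<open>The map in matrix form\<close>
  define A where "A = mat n r (\<lambda>(i, j). M j i)"
  let ?F = "\<lambda>x. map_mat to_ac A *\<^sub>v x + map_vec to_ac (vec n v)"
  have F: "?F x = T x" if "x \<in> carrier_vec r" for x
    using that by (intro eq_vecI)
      (auto simp: A_def T_def scalar_prod_def lessThan_atLeast0 intro!: sum.cong)
  show ?thesis
  proof (intro exI conjI)
    show "A \<in> carrier_mat n r" "vec n v \<in> carrier_vec n" by (simp_all add: A_def)
    have "inj_on T (carrier_vec r)" by (rule inj_on_inverseI[of _ L]) (rule LT)
    thus "inj_on ?F (carrier_vec r)" using F by (simp cong: inj_on_cong)
    show "?F ` V = U" using F V_sub TV by (metis (no_types, lifting) image_cong subsetD)
  qed
qed

end
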